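(* Let $U_1<U_2$ be real numbers, let $W$ be a Gaussian space-time white noise on $\mathbb{R}\times[0,1]$, and let $$x(u)=\int_0^1\int_{\mathbb{R}}p_{1-s}(u-v)\,W(dv,ds),\qquad u\in[U_1,U_2],$$ where $p_t(u)=\frac{1}{\sqrt{2\pi t}}e^{-\frac{u^2}{2t}}$ for $t>0$, $u\in\mathbb{R}$. Then the process $$x_{U_1}(u)=x(u)-x(U_1),\qquad u\in[U_1,U_2],$$ is a Gaussian integrator on $[U_1,U_2]$.
   Context: A Gaussian space-time white noise (Brownian sheet) $W$ on $\mathbb{R}\times[0,1]$ is a centered Gaussian random measure with independent values on disjoint sets and intensity Lebesgue measure; equivalently, the family of stochastic integrals $\int_0^1\int_{\mathbb{R}} g(v,s)\,W(dv,ds)$, $g\in L_2(\mathbb{R}\times[0,1])$ (real), is a centered Gaussian family, linear in $g$, with $E\big(\int_0^1\int_{\mathbb{R}} g\,dW\big)^2=\int_0^1\int_{\mathbb{R}} g(v,s)^2\,dv\,ds$. The process $x(u)$ is the value at time $t=1$ of the solution to the stochastic heat equation $\partial_t x=\frac12\partial_u^2x+W$, $x(\cdot,0)=0$. Gaussian integrator on $[U_1,U_2]$: a centered Gaussian process $y(u)$, $u\in[U_1,U_2]$, with $y(U_1)=0$, for which there exists a constant $c>0$ such that for every partition $U_1=u_0<u_1<\dots<u_n=U_2$ and all real numbers $a_0,\dots,a_{n-1}$ $$E\Big(\sum_{k=0}^{n-1}a_k\big(y(u_{k+1})-y(u_k)\big)\Big)^2\le c\sum_{k=0}^{n-1}a_k^2\,(u_{k+1}-u_k).$$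 *)

theory Defs
  imports "HOL-Probability.Probability"
begin

text \<open>Gaussian laws may be degenerate: the zero random variable counts as Gaussian with variance 0.\<close>

definition centered_gaussian :: "'w measure \<Rightarrow> ('w \<Rightarrow> real) \<Rightarrow> bool" where
  "centered_gaussian M X \<longleftrightarrow>
     X \<in> borel_measurable M \<and>
     ((AE \<omega> in M. X \<omega> = 0) \<or>
      (\<exists>\<sigma>>0. distributed M lborel X (\<lambda>x. ennreal (normal_density 0 \<sigma> x))))"

definition centered_gaussian_family :: "'w measure \<Rightarrow> 'i set \<Rightarrow> ('i \<Rightarrow> 'w \<Rightarrow> real) \<Rightarrow> bool" where
  "centered_gaussian_family M T X \<longleftrightarrow>
     (\<forall>I a. finite I \<and> I \<subseteq> T \<longrightarrow> centered_gaussian M (\<lambda>\<omega>. \<Sum>i\<in>I. a i * X i \<omega>))"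

text \<open>Points of \<open>\<real> \<times> [0,1]\<close> are pairs \<open>(v, s)\<close> of a space and a time coordinate.\<close>

definition strip :: "(real \<times> real) measure" where
  "strip = restrict_space lborel (UNIV \<times> {0..1})"

definition square_integrable :: "'a measure \<Rightarrow> ('a \<Rightarrow> real) set" where
  "square_integrable N = {g \<in> borel_measurable N. integrable N (\<lambda>z. (g z)\<^sup>2)}"

text \<open>
  White noise is represented by its stochastic integrals: \<open>W g\<close> is the random variable
  \<open>\<integral>\<integral> g(v,s) W(dv,ds)\<close>. Linearity holds almost surely, as stochastic integrals are
  determined only up to null sets. Only the values of \<open>W\<close> on square integrable functions
  are constrained.
\<close>

definition white_noise :: "'w measure \<Rightarrow> ((real \<times> real \<Rightarrow> real) \<Rightarrow> 'w \<Rightarrow> real) \<Rightarrow> bool" where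
  "white_noise M W \<longleftrightarrow>
     centered_gaussian_family M (square_integrable strip) W \<and>
     (\<forall>g\<in>square_integrable strip. \<forall>h\<in>square_integrable strip. \<forall>a b.
        AE \<omega> in M. W (\<lambda>z. a * g z + b * h z) \<omega> = a * W g \<omega> + b * W h \<omega>) \<and>
     (\<forall>g\<in>square_integrable strip.
        (LINT \<omega>|M. (W g \<omega>)\<^sup>2) = (LINT z|strip. (g z)\<^sup>2))"

definition heat_kernel :: "real \<Rightarrow> real \<Rightarrow> real" where
  "heat_kernel t u = 1 / sqrt (2 * pi * t) * exp (- (u\<^sup>2 / (2 * t)))"

text \<open>
  The kernel is only meaningful for positive time; the integrand below meets \<open>t = 0\<close>
  only on the null set \<open>s = 1\<close>, where division by zero makes it \<open>0\<close>.
\<close>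

definition heat_process ::
    "((real \<times> real \<Rightarrow> real) \<Rightarrow> 'w \<Rightarrow> real) \<Rightarrow> real \<Rightarrow> 'w \<Rightarrow> real" where
  "heat_process W u = W (\<lambda>(v, s). heat_kernel (1 - s) (u - v))"

definition gaussian_integrator ::
    "'w measure \<Rightarrow> real \<Rightarrow> real \<Rightarrow> (real \<Rightarrow> 'w \<Rightarrow> real) \<Rightarrow> bool" where
  "gaussian_integrator M U1 U2 y \<longleftrightarrow>
     centered_gaussian_family M {U1..U2} y \<and>
     (AE \<omega> in M. y U1 \<omega> = 0) \<and>
     (\<exists>c>0. \<forall>(n::nat) (u :: nat \<Rightarrow> real) (a :: nat \<Rightarrow> real).
        u 0 = U1 \<and> u n = U2 \<and> (\<forall>k<n. u k < u (Suc k)) \<longrightarrow>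
        (LINT \<omega>|M. (\<Sum>k<n. a k * (y (u (Suc k)) \<omega> - y (u k) \<omega>))\<^sup>2)
          \<le> c * (\<Sum>k<n. (a k)\<^sup>2 * (u (Suc k) - u k)))"

end

theory Submission
  imports Defs "HOL-Real_Asymp.Real_Asymp"
begin

text \<open>
  By the isometry of white noise and \<open>p\<^sub>t * p\<^sub>t = p\<^sub>2\<^sub>t\<close>, the covariance of \<open>x(u)\<close> and \<open>x(w)\<close> is
  \<open>K(u - w)\<close> with \<open>K(r) = \<integral>\<^sub>0\<^sup>1 p\<^sub>2\<^sub>t(r) dt\<close>. Explicit integration gives \<open>K(r) = G(r) - \<bar>r\<bar> / 2\<close>, where
  the second derivative of \<open>G\<close> is bounded by \<open>1\<close>. The covariance of two increments of \<open>x\<close> is a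
  second difference of \<open>K\<close>. The kink \<open>- \<bar>r\<bar> / 2\<close> contributes the length of an interval on the
  diagonal and nothing for disjoint intervals, while \<open>G\<close> contributes at most the product of the two
  lengths. Hence the quadratic form is at most
  \<open>\<Sum> a\<^sub>k\<^sup>2 \<Delta>\<^sub>k + (\<Sum> \<bar>a\<^sub>k\<bar> \<Delta>\<^sub>k)\<^sup>2\<close>, and by the Cauchy-Schwarz inequality the constant
  \<open>1 + (U\<^sub>2 - U\<^sub>1)\<close> works.
\<close>

section \<open>The Gaussian error integral\<close>

text \<open>This is \<open>sqrt pi / 2\<close> times the error function. The interval integral is
  oriented, so negative arguments are covered.\<close>

definition gauss_int :: "real \<Rightarrow> real" where
  "gauss_int x = (LBINT z=0..x. exp (- z\<^sup>2))"

text \<open>The closed form of \<open>\<integral>\<^sub>0\<^sup>1 p\<^sub>2\<^sub>t(r) dt\<close>.\<close>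

definition heat_covariance :: "real \<Rightarrow> real" where
  "heat_covariance r = (exp (- (r\<^sup>2 / 4)) - \<bar>r\<bar> * (sqrt pi / 2 - gauss_int (\<bar>r\<bar> / 2))) / sqrt pi"

lemma gauss_int_0 [simp]: "gauss_int 0 = 0"
  by (simp add: gauss_int_def zero_ereal_def)

lemma has_real_derivative_gauss_int:
  "(gauss_int has_real_derivative exp (- x\<^sup>2)) (at x)"
proof -
  have "((\<lambda>u. LBINT z=0..u. exp (- z\<^sup>2)) has_vector_derivative exp (- x\<^sup>2))
      (at x within {-\<bar>x\<bar>-1..\<bar>x\<bar>+1})"
    unfolding zero_ereal_def
    by (rule interval_integral_FTC2) (auto intro!: continuous_intros)
  moreover have "at x within {-\<bar>x\<bar>-1..\<bar>x\<bar>+1} = at x"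
    by (rule at_within_interior) auto
  ultimately show ?thesis
    by (simp add: gauss_int_def[abs_def] has_real_derivative_iff_has_vector_derivative)
qed

lemma gauss_int_minus: "gauss_int (- x) = - gauss_int x"
proof -
  let ?f = "\<lambda>x. gauss_int x + gauss_int (- x)"
  have "(?f has_real_derivative 0) (at x)" for x
    by (auto intro!: derivative_eq_intros DERIV_chain2[OF has_real_derivative_gauss_int])
  from DERIV_isconst_all[of ?f x 0] this have "?f x = ?f 0"
    by blast
  then show ?thesis by simp
qed

text \<open>For \<open>r\<close> other than \<open>0\<close>, this limit makes the antiderivative in
  \<open>heat_kernel_has_integral\<close> tend to \<open>0\<close> as \<open>s\<close> approaches
  \<open>1\<close>.\<close>

lemma gauss_int_at_top: "(gauss_int \<longlongrightarrow> sqrt pi / 2) at_top"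
proof -
  have "((\<lambda>y. LBINT z. indicator {..y} z *\<^sub>R (indicator {0..} z *\<^sub>R exp (- z\<^sup>2)))
      \<longlongrightarrow> (LBINT z. indicator {0..} z *\<^sub>R exp (- z\<^sup>2) :: real)) at_top"
    using gaussian_moment_0 by (intro tendsto_integral_at_top) (auto simp: has_bochner_integral_iff)
  also have "(LBINT z. indicator {0..} z *\<^sub>R exp (- z\<^sup>2) :: real) = sqrt pi / 2"
    using gaussian_moment_0 by (simp add: has_bochner_integral_iff)
  finally show ?thesis
  proof (rule Lim_transform_eventually)
    show "\<forall>\<^sub>F y in at_top. (LBINT z. indicator {..y} z *\<^sub>R (indicator {0..} z *\<^sub>R exp (- z\<^sup>2)))
        = gauss_int y"
      using eventually_ge_at_top[of "0::real"]
    proof eventually_elim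
      case (elim y)
      then have "gauss_int y = (LBINT z : {0..y}. exp (- z\<^sup>2))"
        by (simp add: gauss_int_def zero_ereal_def interval_integral_Icc)
      also have "\<dots> = (LBINT z. indicator {..y} z *\<^sub>R (indicator {0..} z *\<^sub>R exp (- z\<^sup>2)))"
        unfolding set_lebesgue_integral_def
        by (intro Bochner_Integration.integral_cong) (auto split: split_indicator)
      finally show ?case by simp
    qed
  qed
qed

lemma gauss_int_lipschitz: "\<bar>gauss_int x - gauss_int y\<bar> \<le> \<bar>x - y\<bar>"
proof -
  have "norm (gauss_int x - gauss_int y) \<le> 1 * norm (x - y)"
    by (rule field_differentiable_bound[where S = UNIV])
      (auto intro: DERIV_subset[OF has_real_derivative_gauss_int])
  then show ?thesis by simp
qed

section \<open>Second differences of the covariance\<close>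

text \<open>The terms \<open>r / 2 * exp (- (r\<^sup>2 / 4))\<close> coming from the two summands
  cancel, which leaves a derivative with Lipschitz constant \<open>1 / 2\<close>.\<close>

lemma has_real_derivative_smooth_part:
  "((\<lambda>r. exp (- (r\<^sup>2 / 4)) + r * gauss_int (r / 2)) has_real_derivative gauss_int (r / 2)) (at r)"
  by (auto intro!: derivative_eq_intros DERIV_chain2[OF has_real_derivative_gauss_int]
      simp: field_simps power2_eq_square)

text \<open>Oddness of \<open>gauss_int\<close> absorbs all absolute values but one; the remaining
  kink has coefficient \<open>(sqrt pi / 2) / sqrt pi = 1 / 2\<close>.\<close>

lemma heat_covariance_eq:
  "heat_covariance r = (exp (- (r\<^sup>2 / 4)) + r * gauss_int (r / 2)) / sqrt pi - \<bar>r\<bar> / 2"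
  by (cases "r \<ge> 0") (simp_all add: heat_covariance_def gauss_int_minus field_simps)

text \<open>The function \<open>G (x - d) - G (x - c)\<close> of \<open>x\<close> has derivative
  \<open>g (x - d) - g (x - c)\<close>, of size at most \<open>B * (d - c)\<close>; the mean value
  inequality supplies the factor \<open>b - a\<close>.\<close>

lemma smooth_second_difference:
  fixes G :: "real \<Rightarrow> real"
  assumes G: "\<And>r. (G has_real_derivative g r) (at r)"
    and g: "\<And>x y. \<bar>g x - g y\<bar> \<le> B * \<bar>x - y\<bar>"
    and "a \<le> b" "c \<le> d"
  shows "\<bar>G (b - d) - G (b - c) - G (a - d) + G (a - c)\<bar> \<le> B * (b - a) * (d - c)"
proof -
  let ?\<phi> = "\<lambda>x. G (x - d) - G (x - c)"
  have "norm (?\<phi> b - ?\<phi> a) \<le> (B * (d - c)) * norm (b - a)"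
  proof (rule field_differentiable_bound[where S = UNIV])
    show "(?\<phi> has_real_derivative g (z - d) - g (z - c)) (at z within UNIV)" for z
      by (auto intro!: derivative_eq_intros DERIV_chain2[OF G])
    show "norm (g (z - d) - g (z - c)) \<le> B * (d - c)" for z
      using g[of "z - d" "z - c"] \<open>c \<le> d\<close> by simp
  qed auto
  then show ?thesis using \<open>a \<le> b\<close> by (simp add: algebra_simps)
qed

text \<open>The added absolute values compensate the kink, so only the smooth part remains. Its
  constant \<open>1 / (2 * sqrt pi)\<close> is rounded up to \<open>1\<close>.\<close>

lemma heat_covariance_second_difference:
  assumes "a \<le> b" "c \<le> d"
  shows "\<bar>heat_covariance (b - d) - heat_covariance (b - c) - heat_covariance (a - d) + heat_covariance (a - c)
    + (\<bar>b - d\<bar> - \<bar>b - c\<bar> - \<bar>a - d\<bar> + \<bar>a - c\<bar>) / 2\<bar> \<le> (b - a) * (d - c)"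
proof -
  let ?G = "\<lambda>r. exp (- (r\<^sup>2 / 4)) + r * gauss_int (r / 2)"
  have "\<bar>?G (b - d) - ?G (b - c) - ?G (a - d) + ?G (a - c)\<bar> \<le> 1/2 * (b - a) * (d - c)"
    using has_real_derivative_smooth_part
  proof (rule smooth_second_difference)
    show "\<bar>gauss_int (x / 2) - gauss_int (y / 2)\<bar> \<le> 1 / 2 * \<bar>x - y\<bar>" for x y
      using gauss_int_lipschitz[of "x / 2" "y / 2"] by (simp add: field_simps abs_if split: if_splits)
  qed (fact assms)+
  also have "\<dots> \<le> (b - a) * (d - c)"
    using mult_nonneg_nonneg[of "b - a" "d - c"] assms by simp
  finally have *: "\<bar>?G (b - d) - ?G (b - c) - ?G (a - d) + ?G (a - c)\<bar> \<le> (b - a) * (d - c)" .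
  have pi1: "1 \<le> sqrt pi" using pi_gt3 by simp
  have "\<bar>?G (b - d) - ?G (b - c) - ?G (a - d) + ?G (a - c)\<bar> / sqrt pi
      \<le> \<bar>?G (b - d) - ?G (b - c) - ?G (a - d) + ?G (a - c)\<bar> / 1"
    by (rule divide_left_mono) (use pi1 in auto)
  also have "\<dots> \<le> (b - a) * (d - c)" using * by simp
  also have "\<bar>?G (b - d) - ?G (b - c) - ?G (a - d) + ?G (a - c)\<bar> / sqrt pi =
    \<bar>(?G (b - d) - ?G (b - c) - ?G (a - d) + ?G (a - c)) / sqrt pi\<bar>"
    by simp
  finally show ?thesis
    unfolding heat_covariance_eq by (simp add: diff_divide_distrib add_divide_distrib)
qed

text \<open>The four differences have a common sign, so the absolute value acts linearly on them,
  and second differences of linear functions vanish.\<close>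

lemma abs_second_difference_disjoint:
  fixes a b c d :: real
  assumes "a \<le> b" "c \<le> d" "b \<le> c \<or> d \<le> a"
  shows "\<bar>b - d\<bar> - \<bar>b - c\<bar> - \<bar>a - d\<bar> + \<bar>a - c\<bar> = 0"
  using assms by auto

section \<open>Time integral of the heat kernel\<close>

lemma heat_kernel_has_integral:
  "((\<lambda>s. heat_kernel (2 * (1 - s)) r) has_integral heat_covariance r) {0..1}"
proof -
  \<comment> \<open>For \<open>s < 1\<close> this is
    \<open>- sqrt (1 - s) * heat_covariance (r / sqrt (1 - s))\<close>: by scaling, minus the
    integral of the kernel over the remaining time \<open>1 - s\<close>.\<close>
  define J where "J s = - ((sqrt (1 - s) * exp (- (r\<^sup>2 / (4 * (1 - s)))) -
    \<bar>r\<bar> * (sqrt pi / 2 - gauss_int (\<bar>r\<bar> / (2 * sqrt (1 - s))))) / sqrt pi)" for s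
  \<comment> \<open>For \<open>s = 1\<close> the division by zero gives \<open>J\<close> a value different from its left limit \<open>0\<close>.\<close>
  define H where "H s = (if s = 1 then 0 else J s)" for s
  have deriv: "(H has_real_derivative heat_kernel (2 * (1 - s)) r) (at s)" if "s < 1" for s
  proof -
    define q where "q = sqrt (1 - s)"
    define e where "e = exp (- (r\<^sup>2 / (4 * q\<^sup>2)))"
    have q: "q > 0" "1 - s = q\<^sup>2" using that by (auto simp: q_def)
    have sq: "sqrt (1 - s) = q" by (simp add: q_def)
    have q4: "q ^ 4 = (1 - s)\<^sup>2"
      by (simp add: q(2))
    have root: "((\<lambda>s. sqrt (1 - s)) has_real_derivative - (1 / (2 * q))) (at s)"
      using that by (auto intro!: derivative_eq_intros simp: sq field_simps)
    have "((\<lambda>s. c / (1 - s)) has_real_derivative c / q ^ 4) (at s)" for c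
      using that by (auto intro!: derivative_eq_intros simp: q4 power2_eq_square)
    from this[of "- r\<^sup>2 / 4"]
    have "((\<lambda>s. - (r\<^sup>2 / (4 * (1 - s)))) has_real_derivative - (r\<^sup>2 / (4 * q ^ 4))) (at s)"
      by (simp add: divide_divide_eq_left)
    from DERIV_mult'[OF root DERIV_chain2[OF DERIV_exp this]]
    have "((\<lambda>s. sqrt (1 - s) * exp (- (r\<^sup>2 / (4 * (1 - s))))) has_real_derivative
        q * (e * - (r\<^sup>2 / (4 * q ^ 4))) + - (1 / (2 * q)) * e) (at s)"
      using q(1) by (simp add: e_def q(2) sq)
    also have "q * (e * - (r\<^sup>2 / (4 * q ^ 4))) + - (1 / (2 * q)) * e
        = - e / (2 * q) - e * r\<^sup>2 / (4 * q ^ 3)"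
      using q(1) by (simp add: power4_eq_xxxx power3_eq_cube)
    finally have A: "((\<lambda>s. sqrt (1 - s) * exp (- (r\<^sup>2 / (4 * (1 - s))))) has_real_derivative
        - e / (2 * q) - e * r\<^sup>2 / (4 * q ^ 3)) (at s)" .
    have arg: "((\<lambda>s. \<bar>r\<bar> / (2 * sqrt (1 - s))) has_real_derivative \<bar>r\<bar> / (4 * q ^ 3)) (at s)"
    proof (rule DERIV_cong)
      have "((\<lambda>s. \<bar>r\<bar> / 2 * inverse (sqrt (1 - s))) has_real_derivative
          \<bar>r\<bar> / 2 * - (inverse q * - (1 / (2 * q)) * inverse q)) (at s)"
        using DERIV_cmult[OF DERIV_inverse'[OF root], of "\<bar>r\<bar> / 2"] q(1) by (simp add: sq)
      moreover have "\<bar>r\<bar> / 2 * inverse (sqrt (1 - s)) = \<bar>r\<bar> / (2 * sqrt (1 - s))" for s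
        by (simp add: inverse_eq_divide)
      ultimately show "((\<lambda>s. \<bar>r\<bar> / (2 * sqrt (1 - s))) has_real_derivative
          \<bar>r\<bar> / 2 * - (inverse q * - (1 / (2 * q)) * inverse q)) (at s)"
        by (simp only:)
    qed (simp add: power3_eq_cube field_simps)
    have ee: "exp (- (\<bar>r\<bar> / (2 * sqrt (1 - s)))\<^sup>2) = e"
      by (simp add: sq e_def power_divide power_mult_distrib)
    have E: "((\<lambda>s. gauss_int (\<bar>r\<bar> / (2 * sqrt (1 - s)))) has_real_derivative
        e * (\<bar>r\<bar> / (4 * q ^ 3))) (at s)"
      using DERIV_chain2[OF has_real_derivative_gauss_int arg] ee by simp
    have "(J has_real_derivative heat_kernel (2 * (1 - s)) r) (at s)"
    proof (rule DERIV_cong)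
      show "(J has_real_derivative
          - ((- e / (2 * q) - e * r\<^sup>2 / (4 * q ^ 3) - \<bar>r\<bar> * (0 - e * (\<bar>r\<bar> / (4 * q ^ 3)))) / sqrt pi)) (at s)"
        unfolding J_def by (intro DERIV_minus DERIV_cdivide DERIV_diff DERIV_cmult DERIV_const A E)
      \<comment> \<open>The \<open>r\<^sup>2\<close> terms from the exponential and from
        \<open>gauss_int\<close> cancel; only the derivative of the outer square root
        survives.\<close>
      have "\<bar>r\<bar> * (e * (\<bar>r\<bar> / (4 * q ^ 3))) = e * r\<^sup>2 / (4 * q ^ 3)"
        by (simp add: power2_eq_square)
      then have bracket: "- e / (2 * q) - e * r\<^sup>2 / (4 * q ^ 3) - \<bar>r\<bar> * (0 - e * (\<bar>r\<bar> / (4 * q ^ 3))) = - (e / (2 * q))"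
        by (simp only: right_diff_distrib)
      have "heat_kernel (2 * (1 - s)) r = e / (2 * q) / sqrt pi"
        using q(1) by (simp add: q(2) heat_kernel_def real_sqrt_mult e_def)
      then show "- ((- e / (2 * q) - e * r\<^sup>2 / (4 * q ^ 3) - \<bar>r\<bar> * (0 - e * (\<bar>r\<bar> / (4 * q ^ 3)))) / sqrt pi)
          = heat_kernel (2 * (1 - s)) r"
        unfolding bracket by simp
    qed
    moreover have "\<forall>\<^sub>F s in nhds s. H s = J s"
      by (rule eventually_mono[OF eventually_nhds_in_open[OF open_lessThan[of 1], of s]])
        (use that in \<open>simp_all add: H_def\<close>)
    ultimately show ?thesis
      using DERIV_cong_ev by blast
  qed
  \<comment> \<open>For \<open>r = 0\<close> the integrand is unbounded near \<open>s = 1\<close>.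
    The version of the fundamental theorem used here asks for derivatives only in the open interval,
    and for continuity up to its ends.\<close>
  have "((\<lambda>s. heat_kernel (2 * (1 - s)) r) has_integral (H 1 - H 0)) {0..1}"
  proof (rule fundamental_theorem_of_calculus_interior)
    show "(H has_vector_derivative heat_kernel (2 * (1 - s)) r) (at s)" if "s \<in> {0<..<1}" for s
      using that deriv by (simp add: has_real_derivative_iff_has_vector_derivative)
    show "continuous_on {0..1} H"
    proof (rule continuous_on_IccI)
      have "((\<lambda>s. sqrt (1 - s) * exp (- (r\<^sup>2 / (4 * (1 - s))))) \<longlongrightarrow> 0) (at_left 1)"
      proof (rule tendsto_sandwich)
        show "((\<lambda>s::real. 0::real) \<longlongrightarrow> 0) (at_left 1)" by simp
        show "((\<lambda>s::real. sqrt (1 - s)) \<longlongrightarrow> 0) (at_left 1)"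
          by (auto intro!: tendsto_eq_intros)
        show "\<forall>\<^sub>F s::real in at_left 1. 0 \<le> sqrt (1 - s) * exp (- (r\<^sup>2 / (4 * (1 - s))))"
          using eventually_at_left_real[OF zero_less_one] by eventually_elim simp
        show "\<forall>\<^sub>F s::real in at_left 1. sqrt (1 - s) * exp (- (r\<^sup>2 / (4 * (1 - s)))) \<le> sqrt (1 - s)"
          using eventually_at_left_real[OF zero_less_one]
          by eventually_elim (simp add: mult_left_le)
      qed
      moreover have "((\<lambda>s. \<bar>r\<bar> * (sqrt pi / 2 - gauss_int (\<bar>r\<bar> / (2 * sqrt (1 - s))))) \<longlongrightarrow> 0) (at_left 1)"
      \<comment> \<open>For \<open>r = 0\<close> the argument of \<open>gauss_int\<close> stays at
        \<open>0\<close>, and the factor \<open>\<bar>r\<bar>\<close> makes the term vanish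
        instead.\<close>
      proof (cases "r = 0")
        case False
        then have "filterlim (\<lambda>s. \<bar>r\<bar> / (2 * sqrt (1 - s))) at_top (at_left 1)"
          by real_asymp
        from filterlim_compose[OF gauss_int_at_top this] show ?thesis
          by (auto intro!: tendsto_eq_intros)
      qed simp
      ultimately have "(J \<longlongrightarrow> - ((0 - 0) / sqrt pi)) (at_left 1)"
        unfolding J_def by (intro tendsto_intros) auto
      moreover have "\<forall>\<^sub>F s in at_left 1. J s = H s"
        using eventually_at_left_real[OF zero_less_one] by eventually_elim (simp add: H_def)
      ultimately show "(H \<longlongrightarrow> H 1) (at_left 1)"
        by (auto simp: H_def intro: Lim_transform_eventually)
      have cont: "H \<midarrow>s\<rightarrow> H s" if "s < 1" for s
        using DERIV_isCont[OF deriv[OF that]] by (simp add: isCont_def)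
      then show "H \<midarrow>s\<rightarrow> H s" if "s < 1" for s using that .
      show "(H \<longlongrightarrow> H 0) (at_right 0)"
        using cont[of 0] by (simp add: filterlim_at_split)
    qed simp
  qed simp
  then show ?thesis
    by (simp add: H_def J_def heat_covariance_def)
qed

section \<open>Inner products of the heat integrands\<close>

definition heat_integrand :: "real \<Rightarrow> real \<times> real \<Rightarrow> real" where
  "heat_integrand u = (\<lambda>(v, s). heat_kernel (1 - s) (u - v))"

lemma heat_process_eq: "heat_process W u = W (heat_integrand u)"
  by (simp add: heat_process_def heat_integrand_def)

lemma heat_kernel_measurable [measurable]:
  "(\<lambda>z. heat_kernel (f z) (g z)) \<in> borel_measurable N"
  if [measurable]: "f \<in> borel_measurable N" "g \<in> borel_measurable N"
  unfolding heat_kernel_def by measurable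

lemma heat_kernel_nonneg: "t \<ge> 0 \<Longrightarrow> 0 \<le> heat_kernel t u"
  by (simp add: heat_kernel_def)

lemma heat_kernel_eq_normal_density: "t > 0 \<Longrightarrow> heat_kernel t u = normal_density 0 (sqrt t) u"
  by (simp add: heat_kernel_def normal_density_def)

lemma heat_kernel_even: "heat_kernel t (- u) = heat_kernel t u"
  by (simp add: heat_kernel_def)

lemma heat_integrand_measurable: "heat_integrand u \<in> borel_measurable borel"
proof -
  have "heat_integrand u = (\<lambda>z. heat_kernel (1 - snd z) (u - fst z))"
    by (auto simp: heat_integrand_def)
  moreover have "(\<lambda>z::real \<times> real. heat_kernel (1 - snd z) (u - fst z)) \<in> borel_measurable (borel \<Otimes>\<^sub>M borel)"
    by measurable
  ultimately show ?thesis by (simp add: borel_prod)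
qed

text \<open>Tonelli with the space integral inside, so that the convolution identity applies at each
  fixed time.\<close>

lemma nn_integral_strip:
  assumes [measurable]: "f \<in> borel_measurable borel"
  shows "(\<integral>\<^sup>+z. f z \<partial>strip) = (\<integral>\<^sup>+s\<in>{0..1}. (\<integral>\<^sup>+v. f (v, s) \<partial>lborel) \<partial>lborel)"
proof -
  have S: "UNIV \<times> {0..1} \<in> sets (borel :: (real \<times> real) measure)"
    by (intro borel_closed closed_Times) auto
  have [measurable]: "f \<in> borel_measurable (lborel \<Otimes>\<^sub>M lborel)"
    by (simp add: lborel_prod)
  have "(\<integral>\<^sup>+z. f z \<partial>strip) = (\<integral>\<^sup>+z. f z * indicator (UNIV \<times> {0..1}) z \<partial>(lborel \<Otimes>\<^sub>M lborel))"
    using S by (simp add: strip_def nn_integral_restrict_space lborel_prod)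
  also have "\<dots> = (\<integral>\<^sup>+s. \<integral>\<^sup>+v. f (v, s) * indicator (UNIV \<times> {0..1}) (v, s) \<partial>lborel \<partial>lborel)"
    using S by (intro lborel_pair.nn_integral_snd[symmetric]) (simp add: lborel_prod)
  also have "\<dots> = (\<integral>\<^sup>+s\<in>{0..1}. (\<integral>\<^sup>+v. f (v, s) \<partial>lborel) \<partial>lborel)"
    by (intro nn_integral_cong) (simp add: indicator_times nn_integral_multc)
  finally show ?thesis .
qed

text \<open>Evenness of the kernel and a translation of \<open>v\<close> by \<open>w\<close> turn
  the integral into a convolution of two normal densities, whose variances add.\<close>

lemma heat_kernel_convolution:
  assumes "t > 0"
  shows "(\<integral>\<^sup>+v. ennreal (heat_kernel t (u - v) * heat_kernel t (w - v)) \<partial>lborel) = heat_kernel (2 * t) (u - w)"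
proof -
  have *: "heat_kernel t (u - v) * heat_kernel t (w - v)
      = normal_density 0 (sqrt t) ((u - w) - (v - w)) * normal_density 0 (sqrt t) (v - w)" for v
    using assms heat_kernel_even[of t "w - v"] by (simp add: heat_kernel_eq_normal_density)
  have "(\<integral>\<^sup>+v. ennreal (heat_kernel t (u - v) * heat_kernel t (w - v)) \<partial>lborel)
     = (\<integral>\<^sup>+v. ennreal (normal_density 0 (sqrt t) ((u - w) - v) * normal_density 0 (sqrt t) v) \<partial>lborel)"
    unfolding * by (subst (2) nn_integral_real_affine[where c = 1 and t = "- w"]) auto
  also have "\<dots> = normal_density 0 (sqrt ((sqrt t)\<^sup>2 + (sqrt t)\<^sup>2)) (u - w)"
    using fun_cong[OF conv_normal_density_zero_mean[of "sqrt t" "sqrt t"]] assms by simp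
  also have "\<dots> = heat_kernel (2 * t) (u - w)"
    using assms by (simp add: heat_kernel_eq_normal_density)
  finally show ?thesis .
qed

text \<open>The space integral at time \<open>s\<close> is the convolution at time
  \<open>1 - s\<close>, and the time integral of the result is known. As the integrand is
  nonnegative, the computation gives integrability as well.\<close>

lemma heat_integrand_inner:
  "has_bochner_integral strip (\<lambda>z. heat_integrand u z * heat_integrand w z) (heat_covariance (u - w))"
proof (rule has_bochner_integral_nn_integral)
  note [measurable] = heat_integrand_measurable
  let ?K = "\<lambda>s. heat_kernel (2 * (1 - s)) (u - w)"
  have "(\<lambda>z. heat_integrand u z * heat_integrand w z) \<in> borel_measurable borel"
    by measurable
  then show "(\<lambda>z. heat_integrand u z * heat_integrand w z) \<in> borel_measurable strip"
    unfolding strip_def by (intro measurable_restrict_space1) simp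
  show "AE z in strip. 0 \<le> heat_integrand u z * heat_integrand w z"
    by (auto intro!: AE_I2 mult_nonneg_nonneg heat_kernel_nonneg
        simp: strip_def space_restrict_space heat_integrand_def)
  have int: "(?K has_integral heat_covariance (u - w)) {0..1}"
    by (rule heat_kernel_has_integral)
  show "0 \<le> heat_covariance (u - w)"
    using int by (rule has_integral_nonneg) (auto intro!: heat_kernel_nonneg)
  have "(\<integral>\<^sup>+z. ennreal (heat_integrand u z * heat_integrand w z) \<partial>strip)
     = (\<integral>\<^sup>+s\<in>{0..1}. (\<integral>\<^sup>+v. ennreal (heat_integrand u (v, s) * heat_integrand w (v, s)) \<partial>lborel) \<partial>lborel)"
    by (rule nn_integral_strip) measurable
  also have "\<dots> = (\<integral>\<^sup>+s. ennreal (indicator {0..1} s * ?K s) \<partial>lborel)"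
  proof (rule nn_integral_cong_AE)
    show "AE s in lborel. (\<integral>\<^sup>+v. ennreal (heat_integrand u (v, s) * heat_integrand w (v, s)) \<partial>lborel) * indicator {0..1} s
      = ennreal (indicator {0..1} s * ?K s)"
      \<comment> \<open>The convolution identity needs \<open>1 - s > 0\<close>, so the null set
        \<open>s = 1\<close> is removed.\<close>
      using AE_lborel_singleton[of "1::real"]
    proof eventually_elim
      case (elim s)
      then show ?case
        by (auto simp: heat_integrand_def heat_kernel_convolution split: split_indicator)
    qed
  qed
  also have "\<dots> = ennreal (heat_covariance (u - w))"
  proof (rule nn_integral_has_integral_lborel)
    have "((\<lambda>s. if s \<in> {0..1} then ?K s else 0) has_integral heat_covariance (u - w)) UNIV"
      using int by (simp only: has_integral_restrict_UNIV)
    then show "((\<lambda>s. indicator {0..1} s * ?K s) has_integral heat_covariance (u - w)) UNIV"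
      by (rule has_integral_eq[rotated]) auto
    show "0 \<le> indicator {0..1} s * ?K s" for s
      by (auto intro!: heat_kernel_nonneg split: split_indicator)
  qed measurable
  finally show "(\<integral>\<^sup>+z. ennreal (heat_integrand u z * heat_integrand w z) \<partial>strip) = ennreal (heat_covariance (u - w))" .
qed

lemma heat_integrand_square_integrable: "heat_integrand u \<in> square_integrable strip"
proof -
  have "heat_integrand u \<in> borel_measurable strip"
    unfolding strip_def using heat_integrand_measurable by (intro measurable_restrict_space1) simp
  moreover have "integrable strip (\<lambda>z. (heat_integrand u z)\<^sup>2)"
    using heat_integrand_inner[of u u] by (simp add: power2_eq_square has_bochner_integral_iff)
  ultimately show ?thesis by (simp add: square_integrable_def)
qed

section \<open>Linear combinations under white noise\<close>

lemma square_integrable_lincomb: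
  assumes g: "g \<in> square_integrable N" and h: "h \<in> square_integrable N"
  shows "(\<lambda>z. a * g z + b * h z) \<in> square_integrable N"
proof -
  have [measurable]: "g \<in> borel_measurable N" "h \<in> borel_measurable N"
    and i: "integrable N (\<lambda>z. (g z)\<^sup>2)" "integrable N (\<lambda>z. (h z)\<^sup>2)"
    using g h by (auto simp: square_integrable_def)
  have "integrable N (\<lambda>z. (a * g z + b * h z)\<^sup>2)"
  proof (rule Bochner_Integration.integrable_bound)
    show "integrable N (\<lambda>z. 2 * a\<^sup>2 * (g z)\<^sup>2 + 2 * b\<^sup>2 * (h z)\<^sup>2)"
      using i by auto
    have "(a * g z + b * h z)\<^sup>2 \<le> 2 * a\<^sup>2 * (g z)\<^sup>2 + 2 * b\<^sup>2 * (h z)\<^sup>2" for z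
      using zero_le_power2[of "a * g z - b * h z"] by (simp add: power2_eq_square algebra_simps)
    then show "AE z in N. norm ((a * g z + b * h z)\<^sup>2) \<le> norm (2 * a\<^sup>2 * (g z)\<^sup>2 + 2 * b\<^sup>2 * (h z)\<^sup>2)"
      by (intro AE_I2) (simp add: abs_of_nonneg)
  qed measurable
  then show ?thesis by (simp add: square_integrable_def)
qed

lemma square_integrable_sum:
  assumes "finite I" "\<And>i. i \<in> I \<Longrightarrow> g i \<in> square_integrable N"
  shows "(\<lambda>z. \<Sum>i\<in>I. c i * g i z) \<in> square_integrable N"
  using assms
proof (induction I)
  case empty
  then show ?case by (simp add: square_integrable_def)
next
  case (insert i I)
  then show ?case
    using square_integrable_lincomb[of "g i" N "\<lambda>z. \<Sum>i\<in>I. c i * g i z" "c i" 1] by simp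
qed

lemma white_noise_lincomb:
  assumes "white_noise M W" "g \<in> square_integrable strip" "h \<in> square_integrable strip"
  shows "AE \<omega> in M. W (\<lambda>z. a * g z + b * h z) \<omega> = a * W g \<omega> + b * W h \<omega>"
  using assms by (simp add: white_noise_def)

lemma white_noise_sum:
  assumes W: "white_noise M W" and "finite I" "\<And>i. i \<in> I \<Longrightarrow> g i \<in> square_integrable strip"
  shows "AE \<omega> in M. W (\<lambda>z. \<Sum>i\<in>I. c i * g i z) \<omega> = (\<Sum>i\<in>I. c i * W (g i) \<omega>)"
  using assms(2,3)
proof (induction I)
  case empty
  have "(\<lambda>z. 0) \<in> square_integrable strip" by (simp add: square_integrable_def)
  \<comment> \<open>Linearity with both coefficients \<open>0\<close> shows that \<open>W\<close> of
    the zero function vanishes almost surely.\<close>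
  from white_noise_lincomb[OF W this this, of 0 0] show ?case by simp
next
  case (insert i I)
  have "AE \<omega> in M. W (\<lambda>z. c i * g i z + 1 * (\<Sum>i\<in>I. c i * g i z)) \<omega>
      = c i * W (g i) \<omega> + 1 * W (\<lambda>z. \<Sum>i\<in>I. c i * g i z) \<omega>"
    using insert by (intro white_noise_lincomb[OF W] square_integrable_sum) auto
  moreover have "AE \<omega> in M. W (\<lambda>z. \<Sum>i\<in>I. c i * g i z) \<omega> = (\<Sum>i\<in>I. c i * W (g i) \<omega>)"
    using insert by auto
  ultimately show ?case
    by eventually_elim (use insert in simp)
qed

lemma white_noise_gaussian:
  assumes "white_noise M W" "g \<in> square_integrable strip"
  shows "centered_gaussian M (W g)"
proof -
  have *: "centered_gaussian M (\<lambda>\<omega>. \<Sum>i\<in>I. a i * W i \<omega>)"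
    if "finite I" "I \<subseteq> square_integrable strip" for I a
    using assms(1) that by (simp add: white_noise_def centered_gaussian_family_def)
  show ?thesis using *[of "{g}" "\<lambda>_. 1"] assms(2) by simp
qed

text \<open>Needed because \<open>W\<close> is linear only almost surely. Measurability of
  \<open>Y\<close> is a hypothesis since \<open>M\<close> may fail to be complete.\<close>

lemma centered_gaussian_cong_AE:
  assumes X: "centered_gaussian M X" and Y: "Y \<in> borel_measurable M"
    and eq: "AE \<omega> in M. X \<omega> = Y \<omega>"
  shows "centered_gaussian M Y"
proof -
  have [measurable]: "X \<in> borel_measurable M" using X by (simp add: centered_gaussian_def)
  have "distr M lborel X = distr M lborel Y"
    using eq Y by (intro distr_cong_AE) auto
  moreover have "(AE \<omega> in M. X \<omega> = 0) \<longleftrightarrow> (AE \<omega> in M. Y \<omega> = 0)"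
    using eq by (intro eventually_subst) (auto elim: eventually_mono)
  ultimately show ?thesis
    using X Y by (simp add: centered_gaussian_def distributed_def)
qed

section \<open>Increments of the heat process\<close>

definition heat_increment :: "real \<Rightarrow> real \<Rightarrow> real \<times> real \<Rightarrow> real" where
  "heat_increment a b z = heat_integrand b z - heat_integrand a z"

lemma heat_increment_square_integrable: "heat_increment a b \<in> square_integrable strip"
  using square_integrable_lincomb[OF heat_integrand_square_integrable heat_integrand_square_integrable, of 1 b "-1" a]
  by (simp add: heat_increment_def[abs_def])

lemma white_noise_heat_increment:
  assumes "white_noise M W"
  shows "AE \<omega> in M. W (heat_increment a b) \<omega> = heat_process W b \<omega> - heat_process W a \<omega>"
  using white_noise_lincomb[OF assms heat_integrand_square_integrable heat_integrand_square_integrable, of 1 b "-1" a]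
  by (simp add: heat_increment_def[abs_def] heat_process_eq)

lemma white_noise_heat_increment_sum:
  assumes W: "white_noise M W" and I: "finite I"
  shows "AE \<omega> in M. W (\<lambda>z. \<Sum>i\<in>I. c i * heat_increment (a i) (b i) z) \<omega>
    = (\<Sum>i\<in>I. c i * (heat_process W (b i) \<omega> - heat_process W (a i) \<omega>))"
proof -
  have "AE \<omega> in M. \<forall>i\<in>I. W (heat_increment (a i) (b i)) \<omega>
      = heat_process W (b i) \<omega> - heat_process W (a i) \<omega>"
    using I white_noise_heat_increment[OF W] by (simp add: AE_finite_all)
  with white_noise_sum[OF W I heat_increment_square_integrable, of c a b] show ?thesis
    by eventually_elim simp
qed

text \<open>Bilinearity reduces the inner product to four covariances, arranged as the second
  difference bounded earlier.\<close>

lemma heat_increment_inner: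
  "has_bochner_integral strip (\<lambda>z. heat_increment a b z * heat_increment c d z)
    (heat_covariance (b - d) - heat_covariance (b - c) - heat_covariance (a - d) + heat_covariance (a - c))"
proof -
  have "has_bochner_integral strip
     (\<lambda>z. heat_integrand b z * heat_integrand d z - heat_integrand b z * heat_integrand c z
       - heat_integrand a z * heat_integrand d z + heat_integrand a z * heat_integrand c z)
    (heat_covariance (b - d) - heat_covariance (b - c) - heat_covariance (a - d) + heat_covariance (a - c))"
    by (intro has_bochner_integral_add has_bochner_integral_diff heat_integrand_inner)
  then show ?thesis by (simp add: heat_increment_def algebra_simps)
qed

lemma heat_increment_inner_bound:
  assumes "a \<le> b" "c \<le> d"
  shows "\<bar>(LINT z|strip. heat_increment a b z * heat_increment c d z)
      + (\<bar>b - d\<bar> - \<bar>b - c\<bar> - \<bar>a - d\<bar> + \<bar>a - c\<bar>) / 2\<bar> \<le> (b - a) * (d - c)"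
  using heat_covariance_second_difference[OF assms] heat_increment_inner[of a b c d]
  by (simp only: has_bochner_integral_iff)

text \<open>The deterministic core of the integrator bound: the isometry identifies the second
  moment of the weighted increments with this integral.\<close>

lemma heat_increment_sum_norm_le:
  fixes n :: nat and u a :: "nat \<Rightarrow> real"
  assumes u: "\<And>k. k < n \<Longrightarrow> u k < u (Suc k)"
  shows "(LINT z|strip. (\<Sum>k<n. a k * heat_increment (u k) (u (Suc k)) z)\<^sup>2)
    \<le> (1 + (u n - u 0)) * (\<Sum>k<n. (a k)\<^sup>2 * (u (Suc k) - u k))"
proof -
  let ?d = "\<lambda>k. u (Suc k) - u k"
  let ?h = "\<lambda>k. heat_increment (u k) (u (Suc k))"
  have mono: "u i \<le> u j" if "i \<le> j" "j \<le> n" for i j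
    using that
  proof (induction j rule: dec_induct)
    case (step j)
    then show ?case using u[of j] by simp
  qed simp
  \<comment> \<open>The right-hand side is chosen so that its double sum is a perfect square plus a
    diagonal sum.\<close>
  have term_le: "a j * a k * (LINT z|strip. ?h j z * ?h k z)
      \<le> (\<bar>a j\<bar> * ?d j) * (\<bar>a k\<bar> * ?d k) + (if j = k then (a k)\<^sup>2 * ?d k else 0)"
    if jk: "j < n" "k < n" for j k
  proof -
    define x where "x = (LINT z|strip. ?h j z * ?h k z)"
    define A where "A = \<bar>u (Suc j) - u (Suc k)\<bar> - \<bar>u (Suc j) - u k\<bar> - \<bar>u j - u (Suc k)\<bar> + \<bar>u j - u k\<bar>"
    have d: "?d j > 0" "?d k > 0" using u jk by auto
    have x: "\<bar>x + A / 2\<bar> \<le> ?d j * ?d k"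
      unfolding x_def A_def using d by (intro heat_increment_inner_bound) auto
    show ?thesis
    proof (cases "j = k")
      case True
      \<comment> \<open>On the diagonal the kink contributes the length of the interval, the only
        term that is not quadratic in the lengths.\<close>
      then have "A / 2 = - ?d k"
        using d by (simp add: A_def field_simps)
      then have "x \<le> ?d k * ?d k + ?d k"
        using abs_le_D1[OF x] unfolding True by linarith
      then have "(a k)\<^sup>2 * x \<le> (a k)\<^sup>2 * (?d k * ?d k + ?d k)"
        by (rule mult_left_mono) simp
      also have "\<dots> = \<bar>a k\<bar>\<^sup>2 * (?d k * ?d k) + (a k)\<^sup>2 * ?d k"
        by (simp add: distrib_left)
      also have "\<bar>a k\<bar>\<^sup>2 * (?d k * ?d k) = (\<bar>a k\<bar> * ?d k) * (\<bar>a k\<bar> * ?d k)"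
        by (simp only: power2_eq_square mult_ac)
      finally show ?thesis
        using True by (simp add: x_def power2_eq_square)
    next
      case False
      \<comment> \<open>Distinct cells of the partition share at most an endpoint, so the kink
        contributes nothing.\<close>
      then have "u (Suc j) \<le> u k \<or> u (Suc k) \<le> u j"
        using jk mono[of "Suc j" k] mono[of "Suc k" j] by linarith
      then have "A = 0"
        unfolding A_def using d by (intro abs_second_difference_disjoint) auto
      have "a j * a k * x \<le> \<bar>a j * a k\<bar> * \<bar>x\<bar>"
        by (simp flip: abs_mult)
      also have "\<dots> \<le> \<bar>a j * a k\<bar> * (?d j * ?d k)"
        using x \<open>A = 0\<close> by (intro mult_left_mono) auto
      finally show ?thesis
        using False by (simp add: x_def abs_mult mult.commute mult.left_commute)
    qed
  qed
  have "(LINT z|strip. (\<Sum>k<n. a k * ?h k z)\<^sup>2)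
      = (\<Sum>j<n. \<Sum>k<n. a j * a k * (LINT z|strip. ?h j z * ?h k z))"
  proof -
    have "has_bochner_integral strip (\<lambda>z. \<Sum>j<n. \<Sum>k<n. (a j * a k) * (?h j z * ?h k z))
        (\<Sum>j<n. \<Sum>k<n. (a j * a k) * (LINT z|strip. ?h j z * ?h k z))"
      using heat_increment_inner
      by (intro has_bochner_integral_sum has_bochner_integral_mult_right has_bochner_integral_integrable)
        (auto simp: has_bochner_integral_iff)
    moreover have "(\<Sum>j<n. \<Sum>k<n. (a j * a k) * (?h j z * ?h k z)) = (\<Sum>k<n. a k * ?h k z)\<^sup>2" for z
      by (simp add: power2_eq_square sum_product mult_ac)
    ultimately show ?thesis
      by (simp add: has_bochner_integral_iff)
  qed
  also have "\<dots> \<le> (\<Sum>j<n. \<Sum>k<n. (\<bar>a j\<bar> * ?d j) * (\<bar>a k\<bar> * ?d k) + (if j = k then (a k)\<^sup>2 * ?d k else 0))"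
    by (intro sum_mono term_le) auto
  also have "\<dots> = (\<Sum>k<n. \<bar>a k\<bar> * ?d k)\<^sup>2 + (\<Sum>k<n. (a k)\<^sup>2 * ?d k)"
    by (simp add: sum.distrib sum_product power2_eq_square)
  also have "(\<Sum>k<n. \<bar>a k\<bar> * ?d k)\<^sup>2 \<le> (u n - u 0) * (\<Sum>k<n. (a k)\<^sup>2 * ?d k)"
  proof -
    \<comment> \<open>Each length is split into two square roots, so that one Cauchy-Schwarz factor
      telescopes to the total length.\<close>
    have "(\<Sum>k<n. \<bar>a k\<bar> * ?d k)\<^sup>2 = (\<Sum>k<n. sqrt (?d k) * (\<bar>a k\<bar> * sqrt (?d k)))\<^sup>2"
      using u by (intro arg_cong[where f = "\<lambda>x. x\<^sup>2"] sum.cong) (auto simp: less_imp_le)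
    also have "\<dots> \<le> (\<Sum>k<n. (sqrt (?d k))\<^sup>2) * (\<Sum>k<n. (\<bar>a k\<bar> * sqrt (?d k))\<^sup>2)"
      by (rule Cauchy_Schwarz_ineq_sum)
    also have "(\<Sum>k<n. (sqrt (?d k))\<^sup>2) = (\<Sum>k<n. ?d k)"
      using u by (intro sum.cong) (auto simp: less_imp_le)
    also have "\<dots> = u n - u 0"
      by (rule sum_lessThan_telescope)
    also have "(\<Sum>k<n. (\<bar>a k\<bar> * sqrt (?d k))\<^sup>2) = (\<Sum>k<n. (a k)\<^sup>2 * ?d k)"
      using u by (intro sum.cong) (auto simp: less_imp_le power_mult_distrib)
    finally show ?thesis .
  qed
  finally show ?thesis by (simp add: algebra_simps)
qed

theorem theorem2p1:
  fixes M :: "'w measure"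
    and W :: "(real \<times> real \<Rightarrow> real) \<Rightarrow> 'w \<Rightarrow> real"
    and U1 U2 :: real
  assumes "prob_space M"
    and "white_noise M W"
    and "U1 < U2"
  shows "gaussian_integrator M U1 U2 (\<lambda>u \<omega>. heat_process W u \<omega> - heat_process W U1 \<omega>)"
  unfolding gaussian_integrator_def
proof (intro conjI)
  note W = \<open>white_noise M W\<close>
  have meas: "W g \<in> borel_measurable M" if "g \<in> square_integrable strip" for g
    using white_noise_gaussian[OF W that] by (simp add: centered_gaussian_def)
  have [measurable]: "heat_process W u \<in> borel_measurable M" for u
    unfolding heat_process_eq by (intro meas heat_integrand_square_integrable)
  show "centered_gaussian_family M {U1..U2} (\<lambda>u \<omega>. heat_process W u \<omega> - heat_process W U1 \<omega>)"
    unfolding centered_gaussian_family_def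
  proof (intro allI impI, elim conjE)
    fix I :: "real set" and a assume "finite I"
    \<comment> \<open>Each shifted value of the process is almost surely \<open>W\<close> of an
      increment kernel, so the whole combination is almost surely \<open>W\<close> of this one
      function.\<close>
    let ?g = "\<lambda>z. \<Sum>u\<in>I. a u * heat_increment U1 u z"
    have "centered_gaussian M (W ?g)"
      using \<open>finite I\<close>
      by (intro white_noise_gaussian[OF W] square_integrable_sum heat_increment_square_integrable)
    then show "centered_gaussian M (\<lambda>\<omega>. \<Sum>u\<in>I. a u * (heat_process W u \<omega> - heat_process W U1 \<omega>))"
      by (rule centered_gaussian_cong_AE) (use white_noise_heat_increment_sum[OF W \<open>finite I\<close>] in auto)
  qed
  show "AE \<omega> in M. heat_process W U1 \<omega> - heat_process W U1 \<omega> = 0"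
    by simp
  show "\<exists>c>0. \<forall>n u a. u 0 = U1 \<and> u n = U2 \<and> (\<forall>k<n. u k < u (Suc k)) \<longrightarrow>
      (LINT \<omega>|M. (\<Sum>k<n. a k * (heat_process W (u (Suc k)) \<omega> - heat_process W U1 \<omega>
          - (heat_process W (u k) \<omega> - heat_process W U1 \<omega>)))\<^sup>2)
        \<le> c * (\<Sum>k<n. (a k)\<^sup>2 * (u (Suc k) - u k))"
  \<comment> \<open>The factor \<open>1 + (u n - u 0)\<close> from
    \<open>heat_increment_sum_norm_le\<close> takes this value for every partition.\<close>
  proof (intro exI[of _ "1 + (U2 - U1)"] conjI allI impI)
    show "0 < 1 + (U2 - U1)" using \<open>U1 < U2\<close> by simp
    fix n and u a :: "nat \<Rightarrow> real"
    assume u: "u 0 = U1 \<and> u n = U2 \<and> (\<forall>k<n. u k < u (Suc k))"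
    let ?g = "\<lambda>z. \<Sum>k<n. a k * heat_increment (u k) (u (Suc k)) z"
    have g: "?g \<in> square_integrable strip"
      by (intro square_integrable_sum heat_increment_square_integrable) simp
    have [measurable]: "W ?g \<in> borel_measurable M"
      by (rule meas[OF g])
    \<comment> \<open>The common value at \<open>U1\<close> cancels in each increment, and almost
      sure equality suffices under the expectation.\<close>
    have "(LINT \<omega>|M. (\<Sum>k<n. a k * (heat_process W (u (Suc k)) \<omega> - heat_process W U1 \<omega>
          - (heat_process W (u k) \<omega> - heat_process W U1 \<omega>)))\<^sup>2) = (LINT \<omega>|M. (W ?g \<omega>)\<^sup>2)"
      using white_noise_heat_increment_sum[OF W, of "{..<n}" a u "\<lambda>k. u (Suc k)"]
      by (intro integral_cong_AE) auto
    also have "\<dots> = (LINT z|strip. (?g z)\<^sup>2)"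
      using W g by (simp add: white_noise_def)
    also have "\<dots> \<le> (1 + (u n - u 0)) * (\<Sum>k<n. (a k)\<^sup>2 * (u (Suc k) - u k))"
      using u by (intro heat_increment_sum_norm_le) simp
    finally show "(LINT \<omega>|M. (\<Sum>k<n. a k * (heat_process W (u (Suc k)) \<omega> - heat_process W U1 \<omega>
          - (heat_process W (u k) \<omega> - heat_process W U1 \<omega>)))\<^sup>2)
        \<le> (1 + (U2 - U1)) * (\<Sum>k<n. (a k)\<^sup>2 * (u (Suc k) - u k))"
      using u by simp
  qed
qed

end
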